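(* Let $k$ be a positive integer, and suppose $0\le p<\frac1{2k+1}$ and $\frac1{k+1}<t\le1$ with $p\le t$. Then bold play is optimal, i.e. $\pi(p,t)=1-(1-p)^m$ where $m=\lfloor 1/t\rfloor$.
   Context: Let $\beta_1,\beta_2,\ldots$ be independent Bernoulli random variables with success probability $p$. A stake sequence is a sequence $\gamma=(c_1,c_2,\ldots)$ of non-negative reals with $c_1\ge c_2\ge\cdots$ and $\sum_i c_i=1$; write $S_\gamma=\sum_i c_i\beta_i$. For $0\le p\le t\le 1$ define $\pi(p,t)=\sup\{\mathbf P(S_\gamma\ge t)\mid \gamma \text{ a stake sequence}\}$. Bold play for threshold $t$ is the stake sequence with $c_i=\frac1m$ for $i\le m$ and $c_i=0$ for $i>m$, where $m=\lfloor 1/t\rfloor$, whose success probability is $1-(1-p)^m$; bold play is optimal if it attains $\pi(p,t)$. *)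

theory Defs
  imports "HOL-Probability.Probability"
begin

definition stake_seq :: "(nat \<Rightarrow> real) \<Rightarrow> bool" where
  "stake_seq c \<longleftrightarrow> (\<forall>i. 0 \<le> c i) \<and> (\<forall>i. c (Suc i) \<le> c i) \<and> c sums 1"

definition bern_space :: "real \<Rightarrow> (nat \<Rightarrow> bool) measure" where
  "bern_space p = PiM UNIV (\<lambda>_. measure_pmf (bernoulli_pmf p))"

definition stake_sum :: "(nat \<Rightarrow> real) \<Rightarrow> (nat \<Rightarrow> bool) \<Rightarrow> real" where
  "stake_sum c \<omega> = (\<Sum>i. c i * of_bool (\<omega> i))"

definition success_prob :: "real \<Rightarrow> real \<Rightarrow> (nat \<Rightarrow> real) \<Rightarrow> real" where
  "success_prob p t c =
     measure (bern_space p) {\<omega> \<in> space (bern_space p). t \<le> stake_sum c \<omega>}"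

definition pi_opt :: "real \<Rightarrow> real \<Rightarrow> real" where
  "pi_opt p t = (SUP c \<in> {c. stake_seq c}. success_prob p t c)"

end

theory Submission
  imports Defs
begin

text \<open>
  Replace \<open>k\<close> by \<open>m = \<lfloor>1/t\<rfloor> \<le> k\<close> and truncate the stake sequence. Let \<open>X\<close> be the part of the sum
  beyond the stakes \<open>c\<^sub>0, \<dots>, c\<^sub>k\<close>, and put \<open>f i = P(X \<ge> t - c\<^sub>i)\<close>, \<open>g = P(X \<ge> t)\<close>. Counting only
  the failures with at most one success among the first \<open>k + 1\<close> trials, it suffices that
  \<open>p (f 0 + \<dots> + f k) + (1 - p) g \<le> k p\<close>. This follows from two inequalities, both modelled on
  steps in Frankl's work on the Erdos matching conjecture.

  (1) \<open>(1 - p) g \<le> k p f k\<close>: evaluate \<open>E[X; X \<ge> t]\<close> by flipping one success to a failure.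

  (2) \<open>f 0 + \<dots> + f (k - 1) + (k + 1) f k \<le> k\<close>: since \<open>(2k + 1) p \<le> 1\<close>, there are \<open>2k + 1\<close> copies of
  \<open>X\<close> with pairwise disjoint success sets. The copies add up to less than
  \<open>(t - c\<^sub>0) + \<dots> + (t - c\<^sub>k)\<close>, so the thresholds cannot be matched with distinct copies exceeding them.
\<close>

section \<open>Upper tails of finite weighted sums of Bernoulli trials\<close>

definition bern_tail :: "real \<Rightarrow> 'a set \<Rightarrow> ('a \<Rightarrow> real) \<Rightarrow> real \<Rightarrow> real" where
  "bern_tail p V c a =
     measure_pmf.prob (Pi_pmf V False (\<lambda>_. bernoulli_pmf p)) {w. a \<le> (\<Sum>i\<in>V. c i * of_bool (w i))}"

lemma prob_Pi_pmf_bernoulli_insert: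
  assumes "finite V" "x \<notin> V" "0 \<le> p" "p \<le> 1"
  shows "measure_pmf.prob (Pi_pmf (insert x V) False (\<lambda>_. bernoulli_pmf p)) {w. Q w} =
    p * measure_pmf.prob (Pi_pmf V False (\<lambda>_. bernoulli_pmf p)) {w. Q (w(x := True))} +
    (1 - p) * measure_pmf.prob (Pi_pmf V False (\<lambda>_. bernoulli_pmf p)) {w. Q (w(x := False))}"
proof -
  let ?P = "Pi_pmf V False (\<lambda>_. bernoulli_pmf p)"
  have eq: "Pi_pmf (insert x V) False (\<lambda>_. bernoulli_pmf p) =
      bernoulli_pmf p \<bind> (\<lambda>y. map_pmf (\<lambda>f. f(x := y)) ?P)"
    using assms by (simp add: Pi_pmf_insert' map_pmf_def)
  show ?thesis
    unfolding eq measure_pmf_bind using assms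
    by (subst measure_pmf.measure_bind[where N = "count_space UNIV"])
       (auto simp: space_subprob_algebra measure_pmf.subprob_space_axioms
          intro!: arg_cong2[where f = "(+)"] arg_cong2[where f = "(*)"] arg_cong2[where f = measure])
qed

lemma bern_tail_insert:
  assumes "finite V" "x \<notin> V" "0 \<le> p" "p \<le> 1"
  shows "bern_tail p (insert x V) c a = p * bern_tail p V c (a - c x) + (1 - p) * bern_tail p V c a"
proof -
  have s: "(\<Sum>i\<in>insert x V. c i * of_bool ((w(x := b)) i)) =
      c x * of_bool b + (\<Sum>i\<in>V. c i * of_bool (w i))" for w b
    using assms by (auto intro!: sum.cong)
  show ?thesis
    unfolding bern_tail_def prob_Pi_pmf_bernoulli_insert[OF assms] s
    by (simp add: algebra_simps)
qed

lemma bern_tail_le_1: "bern_tail p V c a \<le> 1"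
  and bern_tail_nonneg: "0 \<le> bern_tail p V c a"
  by (simp_all add: bern_tail_def)

text \<open>If all trials in \<open>H\<close> fail, the sum over \<open>H \<union> V\<close> is the
  sum over \<open>V\<close>; by independence the left side is the probability that this happens and
  the sum stays below \<open>a\<close>.\<close>

lemma bern_tail_Un_ge_none:
  assumes "finite H" "finite V" "H \<inter> V = {}" "0 \<le> p" "p \<le> 1"
  shows "(1 - p) ^ card H * (1 - bern_tail p V c a) \<le> 1 - bern_tail p (H \<union> V) c a"
  using assms(1,3)
proof (induction H rule: finite_induct)
  case (insert x H)
  have "(1 - p) ^ card (insert x H) * (1 - bern_tail p V c a) =
      (1 - p) * ((1 - p) ^ card H * (1 - bern_tail p V c a))"
    using insert by simp
  also have "\<dots> \<le> (1 - p) * (1 - bern_tail p (H \<union> V) c a)"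
    using insert assms by (intro mult_left_mono) auto
  also have "\<dots> \<le> (1 - p) * (1 - bern_tail p (H \<union> V) c a) + p * (1 - bern_tail p (H \<union> V) c (a - c x))"
    using assms by (simp add: bern_tail_le_1)
  also have "\<dots> = 1 - bern_tail p (insert x H \<union> V) c a"
    using insert assms by (simp add: bern_tail_insert algebra_simps)
  finally show ?case .
qed simp

text \<open>The two summands come from disjoint ways to stay below \<open>a\<close>: no success in
  \<open>H\<close>, or exactly one, at \<open>i\<close>, with the sum over \<open>V\<close> below
  \<open>a - c i\<close>.\<close>

lemma bern_tail_Un_ge:
  assumes "finite H" "finite V" "H \<inter> V = {}" "0 \<le> p" "p \<le> 1"
  shows "(1 - p) ^ card H * (1 - bern_tail p V c a)
      + p * (1 - p) ^ (card H - 1) * (\<Sum>i\<in>H. 1 - bern_tail p V c (a - c i))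
    \<le> 1 - bern_tail p (H \<union> V) c a"
  using assms(1,3)
proof (induction H rule: finite_induct)
  case (insert x H)
  \<comment> \<open>For empty \<open>H\<close> the truncated exponent \<open>card H - 1\<close> is
    harmless, because the sum vanishes.\<close>
  have *: "p * (1 - p) ^ card H * (\<Sum>i\<in>H. 1 - bern_tail p V c (a - c i)) =
      (1 - p) * (p * (1 - p) ^ (card H - 1) * (\<Sum>i\<in>H. 1 - bern_tail p V c (a - c i)))"
    using insert(1) by (cases "card H") auto
  have "(1 - p) ^ card (insert x H) * (1 - bern_tail p V c a)
      + p * (1 - p) ^ (card (insert x H) - 1) * (\<Sum>i\<in>insert x H. 1 - bern_tail p V c (a - c i)) =
      (1 - p) * ((1 - p) ^ card H * (1 - bern_tail p V c a)
        + p * (1 - p) ^ (card H - 1) * (\<Sum>i\<in>H. 1 - bern_tail p V c (a - c i)))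
      + p * ((1 - p) ^ card H * (1 - bern_tail p V c (a - c x)))"
    using insert(1,2) * by (simp add: algebra_simps)
  \<comment> \<open>If trial \<open>x\<close> fails, the induction hypothesis applies; if it
    succeeds, only outcomes without a success in \<open>H\<close> are counted, at threshold
    \<open>a - c x\<close>.\<close>
  also have "\<dots> \<le> (1 - p) * (1 - bern_tail p (H \<union> V) c a) + p * (1 - bern_tail p (H \<union> V) c (a - c x))"
    using insert assms by (intro add_mono mult_left_mono bern_tail_Un_ge_none) auto
  also have "\<dots> = 1 - bern_tail p (insert x H \<union> V) c a"
    using insert assms by (simp add: bern_tail_insert algebra_simps)
  finally show ?case .
qed simp

section \<open>Flipping a success to a failure\<close>

text \<open>Turning a success at \<open>x\<close> into a failure multiplies the weight by
  \<open>(1 - p) / p\<close>; clearing the denominator covers \<open>p = 0\<close>. On the right,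
  \<open>w\<close> is the outcome after the flip.\<close>

lemma prob_Pi_pmf_bernoulli_swap:
  assumes "finite V" "x \<in> V" "0 \<le> p" "p \<le> 1"
  shows "(1 - p) * measure_pmf.prob (Pi_pmf V False (\<lambda>_. bernoulli_pmf p)) {w. w x \<and> Q w} =
    p * measure_pmf.prob (Pi_pmf V False (\<lambda>_. bernoulli_pmf p)) {w. \<not> w x \<and> Q (w(x := True))}"
proof -
  define U where "U = V - {x}"
  have V: "V = insert x U" and U: "finite U" "x \<notin> U" using assms by (auto simp: U_def)
  show ?thesis
    unfolding V prob_Pi_pmf_bernoulli_insert[OF U assms(3,4)] by simp
qed

lemma finite_set_Pi_pmf_bernoulli: "finite V \<Longrightarrow> finite (set_pmf (Pi_pmf V False (\<lambda>_. bernoulli_pmf p)))"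
  by (rule finite_subset[OF set_Pi_pmf_subset']) auto

text \<open>Pairs of an outcome with sum at least \<open>a\<close> and a success in it are weighted
  by the stake of that success. Before the flip each such outcome contributes at least
  \<open>a\<close>; after it the sum is still at least \<open>a - d\<close>, and the flipped trial
  is one of the failures, whose stakes total at most \<open>sum c V - (a - d)\<close>.\<close>

lemma bern_tail_shift_le:
  fixes c :: "'a \<Rightarrow> real"
  assumes V: "finite V" and p: "0 \<le> p" "p \<le> 1"
    and c: "\<And>i. i \<in> V \<Longrightarrow> 0 \<le> c i" "\<And>i. i \<in> V \<Longrightarrow> c i \<le> d"
  shows "(1 - p) * (a * bern_tail p V c a) \<le>
    p * ((sum c V - (a - d)) * bern_tail p V c (a - d))"
proof -
  define M where "M = Pi_pmf V False (\<lambda>_. bernoulli_pmf p)"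
  define X where "X = (\<lambda>w. \<Sum>i\<in>V. c i * of_bool (w i))"
  have int: "integrable (measure_pmf M) f" for f :: "_ \<Rightarrow> real"
    unfolding M_def by (intro integrable_measure_pmf_finite finite_set_Pi_pmf_bernoulli V)
  have X_upd: "X (w(x := True)) = X w + c x" if "x \<in> V" "\<not> w x" for w x
  proof -
    have "X (w(x := True)) = c x + (\<Sum>i\<in>V - {x}. c i * of_bool (w i))"
      unfolding X_def using V that by (subst sum.remove[of _ x]) (auto intro!: sum.cong)
    moreover have "X w = (\<Sum>i\<in>V - {x}. c i * of_bool (w i))"
      unfolding X_def using V that by (subst sum.remove[of _ x]) auto
    ultimately show ?thesis by simp
  qed
  have "a * bern_tail p V c a = measure_pmf.expectation M (\<lambda>w. a * indicator {w. a \<le> X w} w)"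
    by (simp add: bern_tail_def M_def X_def)
  also have "\<dots> \<le> measure_pmf.expectation M (\<lambda>w. \<Sum>x\<in>V. c x * indicator {w. w x \<and> a \<le> X w} w)"
  proof (intro integral_mono int)
    fix w
    have "(\<Sum>x\<in>V. c x * indicator {w. w x \<and> a \<le> X w} w) = X w * indicator {w. a \<le> X w} w"
      by (auto simp: X_def sum_distrib_right indicator_def intro!: sum.cong)
    thus "a * indicator {w. a \<le> X w} w \<le> (\<Sum>x\<in>V. c x * indicator {w. w x \<and> a \<le> X w} w)"
      by (simp add: indicator_def)
  qed
  also have "\<dots> = (\<Sum>x\<in>V. c x * measure_pmf.prob M {w. w x \<and> a \<le> X w})"
    by (subst Bochner_Integration.integral_sum) (auto intro: int)
  finally have "(1 - p) * (a * bern_tail p V c a) \<le>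
      (1 - p) * (\<Sum>x\<in>V. c x * measure_pmf.prob M {w. w x \<and> a \<le> X w})"
    using p by (intro mult_left_mono) auto
  also have "\<dots> = (\<Sum>x\<in>V. c x * ((1 - p) * measure_pmf.prob M {w. w x \<and> a \<le> X w}))"
    by (simp add: sum_distrib_left algebra_simps)
  also have "\<dots> = (\<Sum>x\<in>V. c x * (p * measure_pmf.prob M {w. \<not> w x \<and> a \<le> X (w(x := True))}))"
    unfolding M_def using V p by (intro sum.cong) (auto simp: prob_Pi_pmf_bernoulli_swap)
  \<comment> \<open>Undoing the flip adds \<open>c x \<le> d\<close>, so \<open>X w\<close> itself
    is at least \<open>a - d\<close>.\<close>
  also have "\<dots> \<le> (\<Sum>x\<in>V. c x * (p * measure_pmf.prob M {w. \<not> w x \<and> a - d \<le> X w}))"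
    using p c by (intro sum_mono mult_left_mono measure_pmf.finite_measure_mono) (force simp: X_upd)+
  also have "\<dots> = p * measure_pmf.expectation M (\<lambda>w. \<Sum>x\<in>V. c x * indicator {w. \<not> w x \<and> a - d \<le> X w} w)"
    by (subst Bochner_Integration.integral_sum) (auto intro: int simp: sum_distrib_left algebra_simps)
  \<comment> \<open>The stakes of the failed trials add up to \<open>sum c V - X w\<close>.\<close>
  also have "\<dots> \<le> p * measure_pmf.expectation M (\<lambda>w. (sum c V - (a - d)) * indicator {w. a - d \<le> X w} w)"
  proof (intro mult_left_mono integral_mono int p)
    fix w
    have "(\<Sum>x\<in>V. c x * indicator {w. \<not> w x \<and> a - d \<le> X w} w) =
        (sum c V - X w) * indicator {w. a - d \<le> X w} w"
      by (auto simp: X_def sum_distrib_right sum_subtractf[symmetric] indicator_def intro!: sum.cong)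
    thus "(\<Sum>x\<in>V. c x * indicator {w. \<not> w x \<and> a - d \<le> X w} w) \<le>
        (sum c V - (a - d)) * indicator {w. a - d \<le> X w} w"
      by (simp add: indicator_def)
  qed
  also have "\<dots> = p * ((sum c V - (a - d)) * bern_tail p V c (a - d))"
    by (simp add: bern_tail_def M_def X_def)
  finally show ?thesis .
qed

section \<open>Threshold counts and disjoint copies\<close>

text \<open>A greedy choice works: \<open>S m\<close> has more elements than the \<open>m\<close>
  values chosen before it.\<close>

lemma increasing_sdr:
  assumes "\<And>m. m < K \<Longrightarrow> finite (S m) \<and> m < card (S m)"
  shows "\<exists>f. inj_on f {..<K::nat} \<and> (\<forall>m<K. f m \<in> S m)"
  using assms
proof (induction K)
  case (Suc K)
  then obtain f where f: "inj_on f {..<K}" "\<forall>m<K. f m \<in> S m" by fastforce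
  have "card (f ` {..<K}) \<le> K" using card_image_le[of "{..<K}" f] by simp
  then have "\<not> S K \<subseteq> f ` {..<K}"
    using Suc.prems[of K] card_mono[of "f ` {..<K}" "S K"] by auto
  then obtain y where "y \<in> S K" "y \<notin> f ` {..<K}" by auto
  with f show ?case
    by (intro exI[of _ "f(K := y)"]) (auto simp: lessThan_Suc less_Suc_eq inj_on_def)
qed auto

text \<open>Were \<open>n i > k - i\<close> for all \<open>i \<le> k\<close>, the thresholds could
  be matched with distinct indices, contradicting \<open>less\<close>. So
  \<open>n i \<le> k - i\<close> for some \<open>i\<close>; all counts from \<open>i\<close> on obey
  the same bound, and the earlier ones are at most \<open>2 * k + 1\<close>.\<close>

lemma threshold_count_le:
  fixes a X :: "nat \<Rightarrow> real"
  assumes mono: "\<And>i j. i \<le> j \<Longrightarrow> j \<le> k \<Longrightarrow> a i \<le> a j"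
    and X: "\<And>j. j < 2 * k + 1 \<Longrightarrow> 0 \<le> X j"
    and less: "(\<Sum>j<2 * k + 1. X j) < (\<Sum>i\<le>k. a i)"
  defines "n \<equiv> \<lambda>i. card {j. j < 2 * k + 1 \<and> a i \<le> X j}"
  shows "(\<Sum>i<k. n i) + (k + 1) * n k \<le> k * (2 * k + 1)"
proof -
  have "\<exists>i\<le>k. n i \<le> k - i"
  proof (rule ccontr)
    assume "\<not> ?thesis"
    then have big: "k - i < n i" if "i \<le> k" for i using that by force
    \<comment> \<open>Indices are chosen from the highest threshold down: the set for
      \<open>a (k - m)\<close> has more than \<open>m\<close> elements.\<close>
    have "\<exists>f. inj_on f {..<Suc k} \<and> (\<forall>m<Suc k. f m \<in> {j. j < 2 * k + 1 \<and> a (k - m) \<le> X j})"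
    proof (intro increasing_sdr)
      fix m assume "m < Suc k"
      then show "finite {j. j < 2 * k + 1 \<and> a (k - m) \<le> X j} \<and> m < card {j. j < 2 * k + 1 \<and> a (k - m) \<le> X j}"
        using big[of "k - m"] by (simp add: n_def)
    qed
    then obtain f where f: "inj_on f {..<Suc k}"
      "\<And>m. m < Suc k \<Longrightarrow> f m < 2 * k + 1 \<and> a (k - m) \<le> X (f m)" by auto
    have "(\<Sum>i\<le>k. a i) = (\<Sum>m<Suc k. a (k - m))"
      by (subst sum.nat_diff_reindex[symmetric]) (simp add: lessThan_Suc_atMost)
    also have "\<dots> \<le> (\<Sum>m<Suc k. X (f m))" using f by (intro sum_mono) auto
    also have "\<dots> = sum X (f ` {..<Suc k})" using f by (simp add: sum.reindex)
    also have "\<dots> \<le> (\<Sum>j<2 * k + 1. X j)" using f X by (intro sum_mono2) auto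
    finally show False using less by simp
  qed
  then obtain i where i: "i \<le> k" "n i \<le> k - i" by auto
  have n_le: "n i' \<le> 2 * k + 1" for i'
    unfolding n_def using card_mono[of "{..<2 * k + 1}" "{j. j < 2 * k + 1 \<and> a i' \<le> X j}"] by auto
  have n_le': "n i' \<le> k - i" if "i \<le> i'" "i' \<le> k" for i'
  proof -
    have "n i' \<le> n i" unfolding n_def
      using mono[OF that] by (intro card_mono) auto
    thus ?thesis using i by simp
  qed
  have "(\<Sum>i<k. n i) = (\<Sum>i'<i. n i') + (\<Sum>i'=i..<k. n i')"
    using i by (metis le0 lessThan_atLeast0 sum.atLeastLessThan_concat)
  also have "\<dots> \<le> i * (2 * k + 1) + (k - i) * (k - i)"
    using sum_bounded_above[of "{..<i}" n "2 * k + 1"] sum_bounded_above[of "{i..<k}" n "k - i"]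
      n_le n_le' by (simp add: add_mono)
  finally have "(\<Sum>i<k. n i) + (k + 1) * n k \<le>
      i * (2 * k + 1) + (k - i) * (k - i) + (k + 1) * (k - i)"
    using n_le'[of k] i by (intro add_mono mult_left_mono) auto
  also have "\<dots> = i * (2 * k + 1) + (k - i) * (k - i + (k + 1))"
    by (simp only: add.assoc mult.commute[of "k + 1"] distrib_left)
  \<comment> \<open>The weight \<open>k + 1\<close> on \<open>n k\<close> fits the
    \<open>2 * k + 1\<close> indices: \<open>k - i + (k + 1) \<le> 2 * k + 1\<close>.\<close>
  also have "\<dots> \<le> i * (2 * k + 1) + (k - i) * (2 * k + 1)"
    by (intro add_left_mono mult_left_mono) auto
  also have "\<dots> = (i + (k - i)) * (2 * k + 1)" by (rule add_mult_distrib[symmetric])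
  also have "\<dots> = k * (2 * k + 1)" using i by simp
  finally show ?thesis .
qed


lemma disjoint_copies_bernoulli:
  assumes "0 < N" "0 \<le> p" "real N * p \<le> 1"
  shows "\<exists>C :: nat pmf. \<forall>j<N. map_pmf (\<lambda>x. x = j) C = bernoulli_pmf p"
proof (intro exI allI impI)
  fix j assume j: "j < N"
  \<comment> \<open>Every trial joins class \<open>j < N\<close> with probability \<open>p\<close>; the value \<open>N\<close> means no class.\<close>
  let ?C = "bernoulli_pmf (real N * p) \<bind> (\<lambda>b. if b then pmf_of_set {..<N} else return_pmf N) :: nat pmf"
  have p: "p \<le> 1" using assms mult_right_mono[of 1 "real N" p] by simp
  have "pmf ?C j = p"
    using assms j by (simp add: pmf_bind indicator_def lessThan_empty_iff)
  moreover have "pmf (map_pmf (\<lambda>x. x = j) ?C) True = pmf ?C j"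
    by (simp add: pmf_map vimage_def measure_pmf_single)
  ultimately have T: "pmf (map_pmf (\<lambda>x. x = j) ?C) True = pmf (bernoulli_pmf p) True"
    using assms p by simp
  \<comment> \<open>The mass at \<open>True\<close> determines a Boolean distribution.\<close>
  have F: "pmf q False = 1 - pmf q True" for q :: "bool pmf"
  proof -
    have "sum (pmf q) UNIV = 1" by (rule sum_pmf_eq_1) auto
    then show ?thesis by (simp add: UNIV_bool)
  qed
  show "map_pmf (\<lambda>x. x = j) ?C = bernoulli_pmf p"
  proof (rule pmf_eqI)
    fix b show "pmf (map_pmf (\<lambda>x. x = j) ?C) b = pmf (bernoulli_pmf p) b"
      using T F by (cases b) simp_all
  qed
qed

text \<open>\<open>threshold_count_le\<close> is averaged over a random assignment of the trials to
  \<open>2 * k + 1\<close> classes or to none. Each class carries a copy of the sum, and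
  disjointness bounds the total of the copies by \<open>sum c V\<close>.\<close>

lemma bern_tail_matching:
  fixes c :: "'a \<Rightarrow> real" and a :: "nat \<Rightarrow> real"
  assumes V: "finite V" and p: "0 \<le> p" "(2 * real k + 1) * p \<le> 1"
    and c: "\<And>i. i \<in> V \<Longrightarrow> 0 \<le> c i"
    and mono: "\<And>i j. i \<le> j \<Longrightarrow> j \<le> k \<Longrightarrow> a i \<le> a j"
    and less: "sum c V < (\<Sum>i\<le>k. a i)"
  shows "(\<Sum>i<k. bern_tail p V c (a i)) + (real k + 1) * bern_tail p V c (a k) \<le> real k"
proof -
  define N where "N = 2 * k + 1"
  have rN: "real N = 2 * real k + 1" by (simp add: N_def)
  obtain C :: "nat pmf" where C: "\<And>j. j < N \<Longrightarrow> map_pmf (\<lambda>x. x = j) C = bernoulli_pmf p"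
    using disjoint_copies_bernoulli[of N p] p unfolding rN[symmetric] by (auto simp: N_def)
  \<comment> \<open>The default \<open>N\<close> means no class, so outside \<open>V\<close> the
    test \<open>x = j\<close> with \<open>j < N\<close> returns the default
    \<open>False\<close>.\<close>
  define M where "M = Pi_pmf V N (\<lambda>_. C)"
  define X where "X = (\<lambda>h (j::nat). \<Sum>i\<in>V. c i * of_bool (h i = j))"
  define n where "n = (\<lambda>h i. card {j. j < N \<and> a i \<le> X h j})"
  have pr: "measure_pmf.prob M {h. b \<le> X h j} = bern_tail p V c b" if "j < N" for j b
  proof -
    have "Pi_pmf V False (\<lambda>_. bernoulli_pmf p) = map_pmf (\<lambda>h. (\<lambda>x. x = j) \<circ> h) M"
      unfolding M_def C[OF that, symmetric] using V that by (intro Pi_pmf_map) auto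
    then show ?thesis
      by (simp add: bern_tail_def X_def vimage_def)
  qed
  have n_alt: "real (n h i) = (\<Sum>j<N. indicator {h. a i \<le> X h j} h)" for h i
  proof -
    have "(\<Sum>j<N. indicator {h. a i \<le> X h j} h) = (\<Sum>j<N. if a i \<le> X h j then 1 else 0::real)"
      by (intro sum.cong) (auto simp: indicator_def)
    also have "\<dots> = (\<Sum>j\<in>{j. j < N \<and> a i \<le> X h j}. 1)"
      by (intro sum.mono_neutral_cong_right) auto
    finally show ?thesis by (simp add: n_def)
  qed
  have int: "integrable (measure_pmf M) (\<lambda>h. real (n h i))" for i
    unfolding n_alt
    by (intro Bochner_Integration.integrable_sum measure_pmf.integrable_const_bound[where B = 1]) auto
  \<comment> \<open>By linearity only the law of each copy enters; the copies need not be
    independent.\<close>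
  have E: "measure_pmf.expectation M (\<lambda>h. real (n h i)) = real N * bern_tail p V c (a i)" for i
    unfolding n_alt by (subst Bochner_Integration.integral_sum) (auto simp: pr intro!: measure_pmf.integrable_const_bound[where B = 1])
  have bound: "(\<Sum>i<k. real (n h i)) + (real k + 1) * real (n h k) \<le> real k * real N" for h
  proof -
    have "(\<Sum>j<N. X h j) = (\<Sum>i\<in>V. c i * (\<Sum>j<N. of_bool (h i = j)))"
      unfolding X_def sum_distrib_left by (rule sum.swap)
    also have "\<dots> \<le> sum c V"
    proof (rule sum_mono)
      fix i assume "i \<in> V"
      moreover have "(\<Sum>j<N. of_bool (h i = j)) \<le> (1::real)"
        by (simp add: of_bool_def sum.delta)
      ultimately show "c i * (\<Sum>j<N. of_bool (h i = j)) \<le> c i"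
        using c mult_left_mono[of _ 1 "c i"] by fastforce
    qed
    finally have "(\<Sum>i<k. n h i) + (k + 1) * n h k \<le> k * N"
      unfolding n_def N_def using less mono
      by (intro threshold_count_le) (auto simp: X_def intro!: sum_nonneg c)
    then have "real ((\<Sum>i<k. n h i) + (k + 1) * n h k) \<le> real (k * N)"
      by (rule of_nat_mono)
    then show ?thesis by (simp add: algebra_simps)
  qed
  have "real N * ((\<Sum>i<k. bern_tail p V c (a i)) + (real k + 1) * bern_tail p V c (a k)) =
      measure_pmf.expectation M (\<lambda>h. (\<Sum>i<k. real (n h i)) + (real k + 1) * real (n h k))"
    using int by (simp add: E sum_distrib_left algebra_simps del: of_nat_sum)
  also have "\<dots> \<le> measure_pmf.expectation M (\<lambda>h. real k * real N)"
    by (intro integral_mono bound Bochner_Integration.integrable_add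
          Bochner_Integration.integrable_sum integrable_mult_right int) auto
  finally show ?thesis
    by (simp add: N_def mult.commute del: of_nat_Suc)
qed

section \<open>The bound for finitely many stakes\<close>

text \<open>The first \<open>k + 1\<close> trials are split off. The failing outcomes with at most
  one success among them already have probability at least \<open>(1 - p) ^ k\<close>.\<close>

lemma bern_tail_le_bold:
  fixes c :: "nat \<Rightarrow> real"
  assumes p: "0 \<le> p" "(2 * real k + 1) * p \<le> 1" and t: "1 < (real k + 1) * t"
    and c: "\<And>i. 0 \<le> c i" "antimono c" "sum c {..<n} \<le> 1" and n: "k < n"
  shows "bern_tail p {..<n} c t \<le> 1 - (1 - p) ^ k"
proof -
  define V where "V = {k<..<n}"
  define f where "f = (\<lambda>i. bern_tail p V c (t - c i))"
  define f0 where "f0 = bern_tail p V c t"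
  have p1: "p \<le> 1" using p mult_right_mono[of 1 "2 * real k + 1" p] by simp
  have t0: "0 < t" using t by (smt (verit) mult_nonneg_nonpos of_nat_0_le_iff)
  have un: "{..<n} = {..k} \<union> V" using n by (auto simp: V_def)
  have split: "sum c {..<n} = sum c {..k} + sum c V"
    unfolding un by (intro sum.union_disjoint) (auto simp: V_def)
  \<comment> \<open>\<open>c k\<close> is the smallest of the first \<open>k + 1\<close> stakes, and
    below it bounds every stake in \<open>V\<close>.\<close>
  have ck: "(real k + 1) * c k \<le> sum c {..k}"
    using sum_bounded_below[of "{..k}" "c k" c] c(2) by (simp add: antimono_def algebra_simps)
  have A: "(1 - p) * f0 \<le> real k * p * f k"
  proof -
    have "(1 - p) * (t * f0) \<le> p * ((sum c V - (t - c k)) * f k)"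
      unfolding f_def f0_def using p p1 c by (intro bern_tail_shift_le) (auto simp: V_def antimono_def)
    also have "\<dots> \<le> p * ((real k * t) * f k)"
    proof (intro mult_left_mono mult_right_mono)
      \<comment> \<open>\<open>split\<close> and \<open>ck\<close> give
        \<open>sum c V \<le> 1 - (k + 1) * c k\<close>; then \<open>1 - t < k * t\<close> is the
        assumption on \<open>t\<close>.\<close>
      have "sum c V - (t - c k) \<le> 1 - t - real k * c k" using ck split c(3) by (simp add: algebra_simps)
      also have "\<dots> \<le> real k * t" using t mult_nonneg_nonneg[OF of_nat_0_le_iff[of k] c(1)[of k]]
        unfolding distrib_right by linarith
      finally show "sum c V - (t - c k) \<le> real k * t" .
    qed (use p in \<open>auto simp: f_def bern_tail_nonneg\<close>)
    finally have "t * ((1 - p) * f0) \<le> t * (real k * p * f k)" by (simp add: algebra_simps)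
    then show ?thesis using t0 by simp
  qed
  have B: "(\<Sum>i<k. f i) + (real k + 1) * f k \<le> real k"
    unfolding f_def
  proof (rule bern_tail_matching)
    \<comment> \<open>The stakes in \<open>V\<close> total at most \<open>1 - sum c {..k}\<close>,
      and \<open>1 < (k + 1) * t\<close>.\<close>
    have "sum c V < (real k + 1) * t - sum c {..k}" using split c(3) t by linarith
    also have "\<dots> = (\<Sum>i\<le>k. t - c i)" by (simp add: sum_subtractf)
    finally show "sum c V < (\<Sum>i\<le>k. t - c i)" .
  qed (use p c in \<open>auto simp: V_def antimono_def\<close>)
  have "(1 - p) ^ k = (1 - p) ^ k * 1" by simp
  also have "\<dots> \<le> (1 - p) ^ k * ((1 - p) * (1 - f0) + p * (\<Sum>i\<le>k. 1 - f i))"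
  proof (rule mult_left_mono)
    have s: "(\<Sum>i\<le>k. 1 - f i) = real k + 1 - (\<Sum>i<k. f i) - f k"
      by (simp add: sum_subtractf lessThan_Suc_atMost[symmetric])
    \<comment> \<open>The bracket is \<open>1\<close> plus \<open>p\<close> times the slack in
      \<open>B\<close> plus the slack in \<open>A\<close>.\<close>
    have "(1 - p) * (1 - f0) + p * (\<Sum>i\<le>k. 1 - f i) =
        1 + p * (real k - ((\<Sum>i<k. f i) + (real k + 1) * f k)) + (real k * p * f k - (1 - p) * f0)"
      unfolding s by (simp add: algebra_simps)
    moreover have "0 \<le> p * (real k - ((\<Sum>i<k. f i) + (real k + 1) * f k))"
      using p B by simp
    ultimately show "1 \<le> (1 - p) * (1 - f0) + p * (\<Sum>i\<le>k. 1 - f i)" using A by linarith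
  qed (use p1 in simp)
  also have "\<dots> = (1 - p) ^ card {..k} * (1 - f0) + p * (1 - p) ^ (card {..k} - 1) * (\<Sum>i\<le>k. 1 - f i)"
    by (simp add: algebra_simps)
  also have "\<dots> \<le> 1 - bern_tail p ({..k} \<union> V) c t"
    unfolding f_def f0_def using p p1 by (intro bern_tail_Un_ge) (auto simp: V_def)
  finally show ?thesis by (simp add: un)
qed

section \<open>From infinitely many trials to finitely many\<close>

text \<open>The event is a finite disjoint union of cylinders, one for each pattern on
  \<open>{..<n}\<close> that satisfies \<open>Q\<close>, and a cylinder has the same weight as its
  pattern.\<close>

lemma measure_bern_space_finite:
  fixes n :: nat
  assumes "\<And>w w'. (\<And>i. i < n \<Longrightarrow> w i = w' i) \<Longrightarrow> Q w = Q w'"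
  shows "{w \<in> space (bern_space p). Q w} \<in> sets (bern_space p)"
    and "measure (bern_space p) {w \<in> space (bern_space p). Q w} =
      measure_pmf.prob (Pi_pmf {..<n} False (\<lambda>_. bernoulli_pmf p)) {w. Q w}"
proof -
  interpret product_prob_space "\<lambda>_. measure_pmf (bernoulli_pmf p)" "UNIV :: nat set"
    by unfold_locales
  \<comment> \<open>Patterns are \<open>False\<close> from \<open>n\<close> on, as are the outcomes
    in the support of \<open>Pi_pmf\<close>.\<close>
  define D where "D = {f \<in> PiE_dflt {..<n} False (\<lambda>_. UNIV :: bool set). Q f}"
  define cyl where "cyl = (\<lambda>f. {w \<in> space (bern_space p). \<forall>i\<in>{..<n}. w i \<in> {f i :: bool}})"
  have fin: "finite D"
    by (rule finite_subset[of _ "PiE_dflt {..<n} False (\<lambda>_. UNIV)"]) (auto simp: D_def)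
  have cyl_sets: "cyl f \<in> sets (bern_space p)" for f
    unfolding cyl_def bern_space_def
    by (intro sets.sets_Collect_finite_All sets_Collect_single') auto
  have cyl: "measure (bern_space p) (cyl f) = pmf (Pi_pmf {..<n} False (\<lambda>_. bernoulli_pmf p)) f"
    if "f \<in> D" for f
  proof -
    have "emeasure (bern_space p) (cyl f) = (\<Prod>i<n. emeasure (measure_pmf (bernoulli_pmf p)) {f i})"
      unfolding cyl_def bern_space_def by (rule emeasure_PiM_Collect) auto
    also have "\<dots> = ennreal (\<Prod>i<n. pmf (bernoulli_pmf p) (f i))"
      by (simp add: emeasure_pmf_single prod_ennreal)
    finally have "measure (bern_space p) (cyl f) = (\<Prod>i<n. pmf (bernoulli_pmf p) (f i))"
      by (simp add: measure_def prod_nonneg)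
    also have "\<dots> = pmf (Pi_pmf {..<n} False (\<lambda>_. bernoulli_pmf p)) f"
      using that by (intro pmf_Pi'[symmetric]) (auto simp: D_def PiE_dflt_def)
    finally show ?thesis .
  qed
  have U: "{w \<in> space (bern_space p). Q w} = (\<Union>f\<in>D. cyl f)"
  proof safe
    fix w assume w: "w \<in> space (bern_space p)" "Q w"
    have "Q (\<lambda>i. i < n \<and> w i)" using assms[of "\<lambda>i. i < n \<and> w i" w] w by simp
    then show "w \<in> (\<Union>f\<in>D. cyl f)"
      using w by (intro UN_I[of "\<lambda>i. i < n \<and> w i"]) (auto simp: D_def PiE_dflt_def cyl_def)
  next
    fix w f assume "f \<in> D" "w \<in> cyl f"
    then show "w \<in> space (bern_space p)" "Q w"
      using assms[of f w] by (auto simp: D_def cyl_def)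
  qed
  show "{w \<in> space (bern_space p). Q w} \<in> sets (bern_space p)"
    unfolding U using fin cyl_sets by auto
  have disj: "disjoint_family_on cyl D"
    unfolding disjoint_family_on_def
  proof safe
    fix f g w assume fg: "f \<in> D" "g \<in> D" "f \<noteq> g" "w \<in> cyl f" "w \<in> cyl g"
    then have "f i = g i" for i
      by (cases "i < n") (auto simp: D_def cyl_def PiE_dflt_def)
    with fg show "w \<in> {}" by auto
  qed
  have "measure (bern_space p) {w \<in> space (bern_space p). Q w} = (\<Sum>f\<in>D. measure (bern_space p) (cyl f))"
    unfolding U using fin disj cyl_sets
    by (intro measure_finite_Union) (auto simp: bern_space_def)
  also have "\<dots> = measure_pmf.prob (Pi_pmf {..<n} False (\<lambda>_. bernoulli_pmf p)) D"
    using fin by (simp add: cyl measure_measure_pmf_finite)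
  also have "\<dots> = measure_pmf.prob (Pi_pmf {..<n} False (\<lambda>_. bernoulli_pmf p)) {w. Q w}"
    by (intro measure_pmf.finite_measure_eq_AE)
       (auto simp: D_def PiE_dflt_def AE_measure_pmf_iff dest!: set_mp[OF set_Pi_pmf_subset, rotated])
  finally show "measure (bern_space p) {w \<in> space (bern_space p). Q w} =
      measure_pmf.prob (Pi_pmf {..<n} False (\<lambda>_. bernoulli_pmf p)) {w. Q w}" .
qed

text \<open>At best every trial from \<open>n\<close> on succeeds.\<close>

lemma stake_sum_le_truncation:
  assumes "stake_seq c"
  shows "stake_sum c w \<le> (\<Sum>i<n. c i * of_bool (w i)) + (1 - sum c {..<n})"
proof -
  have c: "0 \<le> c i" "summable c" "suminf c = 1" for i
    using assms by (auto simp: stake_seq_def sums_iff)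
  have s: "summable (\<lambda>i. c i * of_bool (w i))"
    by (rule summable_comparison_test'[OF c(2), of 0]) (use c in auto)
  have "stake_sum c w = (\<Sum>i. c (i + n) * of_bool (w (i + n))) + (\<Sum>i<n. c i * of_bool (w i))"
    unfolding stake_sum_def by (rule suminf_split_initial_segment[OF s])
  also have "(\<Sum>i. c (i + n) * of_bool (w (i + n))) \<le> (\<Sum>i. c (i + n))"
    using c s by (intro suminf_le) (auto simp: summable_iff_shift[of c] summable_iff_shift[of "\<lambda>i. c i * of_bool (w i)"])
  also have "(\<Sum>i. c (i + n)) = 1 - sum c {..<n}"
    using suminf_minus_initial_segment[OF c(2), of n] c by simp
  finally show ?thesis by simp
qed

text \<open>The strict inequality for \<open>t\<close> leaves room: for large \<open>n\<close>,
  granting success to all trials from \<open>n\<close> on lowers the threshold to some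
  \<open>a\<close> that still satisfies \<open>1 < (k + 1) * a\<close>.\<close>

lemma success_prob_le:
  assumes p: "0 \<le> p" "(2 * real k + 1) * p \<le> 1" and t: "1 < (real k + 1) * t"
    and c: "stake_seq c"
  shows "success_prob p t c \<le> 1 - (1 - p) ^ k"
proof -
  interpret product_prob_space "\<lambda>_. measure_pmf (bernoulli_pmf p)" "UNIV :: nat set"
    by unfold_locales
  have c': "0 \<le> c i" "c (Suc i) \<le> c i" "c sums 1" for i
    using c by (auto simp: stake_seq_def)
  have "(\<lambda>n. (real k + 1) * (t - (1 - sum c {..<n}))) \<longlonglongrightarrow> (real k + 1) * (t - (1 - 1))"
    using c'(3) unfolding sums_def by (intro tendsto_intros)
  then have "\<forall>\<^sub>F n in sequentially. 1 < (real k + 1) * (t - (1 - sum c {..<n}))"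
    using t by (intro order_tendstoD) auto
  then have "\<forall>\<^sub>F n in sequentially. 1 < (real k + 1) * (t - (1 - sum c {..<n})) \<and> k < n"
    using eventually_gt_at_top[of k] by eventually_elim simp
  then have "\<exists>n. 1 < (real k + 1) * (t - (1 - sum c {..<n})) \<and> k < n"
    by (rule eventually_happens'[OF sequentially_bot])
  then obtain n where n: "1 < (real k + 1) * (t - (1 - sum c {..<n}))" "k < n" by blast
  define a where "a = t - (1 - sum c {..<n})"
  define Q where "Q = (\<lambda>w. a \<le> (\<Sum>i<n. c i * of_bool (w i)))"
  have Q: "Q w = Q w'" if "\<And>i. i < n \<Longrightarrow> w i = w' i" for w w'
  proof -
    have "(\<Sum>i<n. c i * of_bool (w i)) = (\<Sum>i<n. c i * of_bool (w' i))"
      using that by (intro sum.cong) auto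
    then show ?thesis by (simp only: Q_def)
  qed
  have "success_prob p t c \<le> measure (bern_space p) {w \<in> space (bern_space p). Q w}"
    unfolding success_prob_def
  \<comment> \<open>Monotonicity asks for measurability of the larger event, which depends on the
    first \<open>n\<close> trials only.\<close>
  proof (rule finite_measure.finite_measure_mono)
    show "finite_measure (bern_space p)" unfolding bern_space_def by unfold_locales
    show "{w \<in> space (bern_space p). t \<le> stake_sum c w} \<subseteq> {w \<in> space (bern_space p). Q w}"
    proof (intro subsetI CollectI conjI)
      fix w assume "w \<in> {w \<in> space (bern_space p). t \<le> stake_sum c w}"
      then show "w \<in> space (bern_space p)" "Q w"
        using stake_sum_le_truncation[OF c, of w n] unfolding Q_def a_def by auto
    qed
  qed (rule measure_bern_space_finite(1)[of n Q, OF Q])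
  also have "\<dots> = bern_tail p {..<n} c a"
    using measure_bern_space_finite(2)[of n Q, OF Q] unfolding bern_tail_def Q_def by simp
  also have "\<dots> \<le> 1 - (1 - p) ^ k"
  proof (rule bern_tail_le_bold)
    show "antimono c" using c'(2) by (rule decseq_SucI)
    show "sum c {..<n} \<le> 1"
      using sum_le_suminf[of c "{..<n}"] c' by (auto simp: sums_iff)
  qed (use p n c' a_def in auto)
  finally show ?thesis .
qed

section \<open>Bold play and the supremum\<close>

definition bold_play :: "nat \<Rightarrow> nat \<Rightarrow> real" where
  "bold_play m i = (if i < m then 1 / real m else 0)"

lemma stake_seq_bold_play: "0 < m \<Longrightarrow> stake_seq (bold_play m)"
  using sums_finite[of "{..<m}" "bold_play m"] by (auto simp: stake_seq_def bold_play_def)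

text \<open>As \<open>0 < t \<le> 1 / m\<close>, bold play fails exactly when the first
  \<open>m\<close> trials all fail.\<close>

lemma success_prob_bold_play:
  assumes "0 < m" "0 < t" "t \<le> 1 / real m" "0 \<le> p" "p \<le> 1"
  shows "success_prob p t (bold_play m) = 1 - (1 - p) ^ m"
proof -
  interpret product_prob_space "\<lambda>_. measure_pmf (bernoulli_pmf p)" "UNIV :: nat set"
    by unfold_locales
  have P: "prob_space (bern_space p)" unfolding bern_space_def by unfold_locales
  define A where "A = {w \<in> space (bern_space p). \<forall>i\<in>{..<m}. w i \<in> {False}}"
  have A: "A \<in> sets (bern_space p)" unfolding A_def bern_space_def
    by (intro sets.sets_Collect_finite_All sets_Collect_single') auto
  have "emeasure (bern_space p) A = (\<Prod>i<m. emeasure (measure_pmf (bernoulli_pmf p)) {False})"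
    unfolding A_def bern_space_def by (rule emeasure_PiM_Collect) auto
  then have mA: "measure (bern_space p) A = (1 - p) ^ m"
    using assms by (simp add: measure_def emeasure_pmf_single ennreal_power)
  have sum: "stake_sum (bold_play m) w = (\<Sum>i<m. 1 / real m * of_bool (w i))" for w
    unfolding stake_sum_def by (subst suminf_finite[of "{..<m}"]) (auto simp: bold_play_def)
  have "t \<le> stake_sum (bold_play m) w \<longleftrightarrow> (\<exists>i<m. w i)" for w
  proof
    assume "\<exists>i<m. w i"
    then obtain i where i: "i < m" "w i" by auto
    have "1 / real m * of_bool (w i) \<le> (\<Sum>i<m. 1 / real m * of_bool (w i))"
      using i by (intro member_le_sum) auto
    then show "t \<le> stake_sum (bold_play m) w" using assms i by (simp add: sum)
  next
    assume w: "t \<le> stake_sum (bold_play m) w"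
    show "\<exists>i<m. w i"
    proof (rule ccontr)
      assume "\<not> (\<exists>i<m. w i)"
      then have "stake_sum (bold_play m) w = 0" unfolding sum by (intro sum.neutral) auto
      then show False using w assms by simp
    qed
  qed
  then have "{w \<in> space (bern_space p). t \<le> stake_sum (bold_play m) w} = space (bern_space p) - A"
    by (auto simp: A_def)
  then show ?thesis
    unfolding success_prob_def using prob_space.prob_compl[OF P A] mA by simp
qed

theorem theorem19:
  fixes k :: nat and p t :: real
  assumes "0 < k"
    and "0 \<le> p" and "p < 1 / (2 * real k + 1)"
    and "1 / (real k + 1) < t" and "t \<le> 1"
    and "p \<le> t"
  shows "pi_opt p t = 1 - (1 - p) ^ nat \<lfloor>1 / t\<rfloor>"
proof -
  define m where "m = nat \<lfloor>1 / t\<rfloor>"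
  have t0: "0 < t" using assms(4) by (rule less_trans[rotated]) simp
  have fl: "1 \<le> \<lfloor>1 / t\<rfloor>" using t0 assms(5) by simp
  have m: "real m = of_int \<lfloor>1 / t\<rfloor>" "0 < m" using fl unfolding m_def by linarith+
  have mt: "real m \<le> 1 / t" "1 / t < real m + 1" unfolding m by linarith+
  have mt': "t \<le> 1 / real m" "1 < (real m + 1) * t"
    using mt t0 m(2) by (auto simp: field_simps)
  \<comment> \<open>The bound is applied with \<open>m\<close> for \<open>k\<close>:
    \<open>m \<le> k\<close> passes the condition on \<open>p\<close> to \<open>m\<close>, and
    \<open>1 < (m + 1) * t\<close> holds by the choice of \<open>m\<close>.\<close>
  have "1 / t < real k + 1" using assms(4) t0 by (simp add: field_simps)
  then have "m \<le> k" using mt by linarith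
  then have "(2 * real m + 1) * p \<le> (2 * real k + 1) * p"
    using assms(2) by (intro mult_right_mono) auto
  also have "\<dots> \<le> 1" using assms(3) by (simp add: field_simps)
  finally have p: "(2 * real m + 1) * p \<le> 1" .
  have p1: "p \<le> 1" using assms by simp
  have "pi_opt p t = success_prob p t (bold_play m)"
    unfolding pi_opt_def
  proof (rule cSup_eq_maximum)
    show "success_prob p t (bold_play m) \<in> success_prob p t ` {c. stake_seq c}"
      using stake_seq_bold_play[OF m(2)] by blast
    show "x \<le> success_prob p t (bold_play m)" if "x \<in> success_prob p t ` {c. stake_seq c}" for x
      using that success_prob_le[OF assms(2) p mt'(2)]
        success_prob_bold_play[OF m(2) t0 mt'(1) assms(2) p1] by auto
  qed
  then show ?thesis
    using success_prob_bold_play[OF m(2) t0 mt'(1) assms(2) p1] by (simp add: m_def)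
qed

end
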